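(* Let $d$ be a positive integer, let $U$ be an open subset of $\mathbb{R}^d$, and let $L_1,\ldots,L_r$ be linear partial differential operators on $U$ with coefficients from $\mathcal{C}(U)$. Then the following are equivalent: (1) For every $\phi \in \mathcal{C}^{(\infty)}_c(U)$, the functions $L_1\phi,\ldots,L_r\phi$ are linearly dependent (over $\mathbb{R}$) in $\mathcal{C}(U)$. (2) $L_1,\ldots,L_r$ are linearly dependent (over $\mathbb{R}$). The equivalence of (1) and (2) also holds when, in (1), the vector space $\mathcal{C}^{(\infty)}_c(U)$ is replaced with the vector space $\mathbb{R}[x_1,\ldots,x_d]$ of real polynomials (acting as functions on $U$).
   Context: $\mathcal{C}(U)$ is the real vector space of all continuous real functions on $U$, and $\mathcal{C}^{(\infty)}_c(U)$ is the real vector space of all infinitely differentiable real functions with compact support on $U$. A linear partial differential operator with coefficients from $\mathcal{C}(U)$ is a finite sum $L=\sum_{\alpha} p_\alpha D^\alpha$ with $\alpha=(\alpha_1,\ldots,\alpha_d)\in\mathbb{N}_0^d$, $p_\alpha\in\mathcal{C}(U)$ and $D^\alpha=\frac{\partial^{|\alpha|}}{(\partial x_1)^{\alpha_1}\cdots(\partial x_d)^{\alpha_d}}$, $|\alpha|=\alpha_1+\cdots+\alpha_d$. A finite list of elements $v_1,\ldots,v_r$ ($r\ge 1$) of a real vector space is linearly dependent if there are real constants $c_1,\ldots,c_r$, not all zero, with $c_1v_1+\cdots+c_rv_r=0$; for operators, $\sum_i c_iL_i=0$ means that all coefficient functions of $\sum_i c_iL_i$ vanish on $U$. *)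

theory Defs
  imports "HOL-Analysis.Analysis"
begin

text \<open>Real functions on an open set \<open>U\<close> are represented by total functions. Since \<open>U\<close> is
  open, their values outside \<open>U\<close> do not affect derivatives at points of \<open>U\<close>, nor any of the
  predicates below.\<close>

definition partial :: "'d \<Rightarrow> (real^'d \<Rightarrow> real) \<Rightarrow> real^('d::finite) \<Rightarrow> real" where
  "partial i f = (\<lambda>x. deriv (\<lambda>t. f (x + t *\<^sub>R axis i 1)) 0)"

text \<open>\<open>deriv\<close> returns an arbitrary value where the derivative does not exist, so existence of every
  iterated partial derivative is demanded explicitly, besides its continuity.\<close>

definition smooth_on :: "(real^'d) set \<Rightarrow> (real^'d \<Rightarrow> real) \<Rightarrow> bool" where
  "smooth_on U f \<longleftrightarrow>
    (\<forall>is. continuous_on U (foldr partial is f) \<and>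
      (\<forall>i. \<forall>x\<in>U. (\<lambda>t. foldr partial is f (x + t *\<^sub>R axis i 1)) differentiable (at 0)))"

text \<open>The support is the closure relative to \<open>U\<close>, so compactness forces it to keep away from the
  boundary of \<open>U\<close>.\<close>

definition Cinf_c :: "(real^'d) set \<Rightarrow> (real^'d \<Rightarrow> real) set" where
  "Cinf_c U = {\<phi>. smooth_on U \<phi> \<and> compact (U \<inter> closure {x\<in>U. \<phi> x \<noteq> 0})}"

text \<open>\<open>multi_deriv \<alpha>\<close> composes the partial derivatives in the order of the coordinates, hence the
  order on the index type.\<close>

definition multi_deriv ::
  "('d \<Rightarrow> nat) \<Rightarrow> ((real, 'd::{finite,linorder}) vec \<Rightarrow> real) \<Rightarrow> (real, 'd) vec \<Rightarrow> real" where
  "multi_deriv \<alpha> = foldr (\<lambda>i. partial i ^^ \<alpha> i) (sorted_list_of_set UNIV)"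

text \<open>The operator with coefficients \<open>p\<^sub>\<alpha>\<close> is the family \<open>\<alpha> \<mapsto> p\<^sub>\<alpha>\<close>.\<close>

type_synonym 'd diff_op = "('d \<Rightarrow> nat) \<Rightarrow> real^'d \<Rightarrow> real"

definition linear_pdo :: "(real^'d) set \<Rightarrow> ('d::finite) diff_op \<Rightarrow> bool" where
  "linear_pdo U L \<longleftrightarrow> finite {\<alpha>. \<exists>x\<in>U. L \<alpha> x \<noteq> 0} \<and> (\<forall>\<alpha>. continuous_on U (L \<alpha>))"

definition apply_op ::
  "(real, 'd::{finite,linorder}) vec set \<Rightarrow> 'd diff_op \<Rightarrow> ((real, 'd) vec \<Rightarrow> real) \<Rightarrow>
    (real, 'd) vec \<Rightarrow> real" where
  "apply_op U L \<phi> = (\<lambda>x. \<Sum>\<alpha> | \<exists>y\<in>U. L \<alpha> y \<noteq> 0. L \<alpha> x * multi_deriv \<alpha> \<phi> x)"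

text \<open>Linear dependence of the lists \<open>f 1, \<dots>, f r\<close> and \<open>L 1, \<dots>, L r\<close>; repeated entries count,
  unlike for the set-based \<open>dependent\<close>.\<close>

definition lin_dep_funs :: "(real^'d) set \<Rightarrow> nat \<Rightarrow> (nat \<Rightarrow> real^'d \<Rightarrow> real) \<Rightarrow> bool" where
  "lin_dep_funs U r f \<longleftrightarrow>
    (\<exists>c::nat \<Rightarrow> real. (\<exists>i\<in>{1..r}. c i \<noteq> 0) \<and> (\<forall>x\<in>U. (\<Sum>i=1..r. c i * f i x) = 0))"

definition lin_dep_ops :: "(real^'d) set \<Rightarrow> nat \<Rightarrow> (nat \<Rightarrow> ('d::finite) diff_op) \<Rightarrow> bool" where
  "lin_dep_ops U r L \<longleftrightarrow>
    (\<exists>c::nat \<Rightarrow> real. (\<exists>i\<in>{1..r}. c i \<noteq> 0) \<and> (\<forall>\<alpha>. \<forall>x\<in>U. (\<Sum>i=1..r. c i * L i \<alpha> x) = 0))"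

end

theory Submission
  imports Defs
begin

text \<open>
  That (2) implies (1) is immediate: the relation \<open>\<Sum> c\<^sub>i L\<^sub>i = 0\<close> between the coefficients can be
  applied to every \<open>\<phi>\<close>.

  For the converse, let \<open>L\<^sub>1, \<dots>, L\<^sub>r\<close> be independent. It suffices to exhibit one test function
  \<open>\<phi>\<close> for which \<open>L\<^sub>1 \<phi>, \<dots>, L\<^sub>r \<phi>\<close> are independent. Write \<open>L\<^sub>i = \<Sum> p\<^sub>i\<^sub>,\<^sub>\<alpha> D\<^sup>\<alpha>\<close>. Independence
  means that the functions \<open>(x, \<alpha>) \<mapsto> p\<^sub>i\<^sub>,\<^sub>\<alpha>(x)\<close> are independent, so finitely many pairs
  \<open>(x, a x)\<close> already detect every nontrivial combination \<open>c\<close>. Since the coefficients are continuous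
  and \<open>U\<close> has no isolated points, the points \<open>x\<close> can be kept distinct, so that the multi-index
  is a function \<open>a\<close> of the point (lemma \<open>separating_points\<close>). Now choose \<open>\<phi>\<close> whose jet at each chosen point
  \<open>x\<close>, up to the order of the operators, is that of \<open>(y - x)\<^sup>a/a!\<close> with \<open>a = a x\<close>. Then
  \<open>L\<^sub>i \<phi> (x) = p\<^sub>i\<^sub>,\<^sub>a(x)\<close>, and a relation between the functions \<open>L\<^sub>i \<phi>\<close> must be trivial, by its values
  at the chosen points (lemma \<open>interpolation_imp_lin_dep_ops\<close>).

  Such a \<open>\<phi>\<close> is obtained from functions \<open>g\<^sub>x\<close> that are \<open>1\<close> at \<open>x\<close> and \<open>0\<close> at the other points.
  The function \<open>1 - (1 - g\<^sub>x\<^sup>n)\<^sup>n\<close> agrees with \<open>1\<close> to order \<open>n\<close> at \<open>x\<close> and with \<open>0\<close> to order \<open>n\<close>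
  at the other points; multiplying it with the monomial centred at \<open>x\<close> and summing over \<open>x\<close>
  gives \<open>\<phi>\<close> (lemma \<open>multi_deriv_jet_interpolant\<close>). Lagrange polynomials \<open>g\<^sub>x\<close> yield a
  polynomial \<open>\<phi>\<close>, and bump functions \<open>g\<^sub>x\<close> yield \<open>\<phi>\<close> smooth with compact support.
\<close>

section \<open>An algebra of smooth functions\<close>

text \<open>
  Multiples of the standard flat function \<open>exp (-1/t)\<close> by polynomials in \<open>1/t\<close>. Allowing the factor
  \<open>p\<close> makes the family closed under differentiation.
\<close>

definition flat_exp :: "real poly \<Rightarrow> real \<Rightarrow> real" where
  "flat_exp p t = (if t \<le> 0 then 0 else poly p (inverse t) * exp (- inverse t))"

lemma poly_times_exp_minus_tendsto_0:
  fixes p :: "real poly"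
  shows "((\<lambda>s. poly p s * exp (- s)) \<longlongrightarrow> 0) at_top"
proof -
  have "((\<lambda>s. \<Sum>k\<le>degree p. coeff p k * (s ^ k / exp s)) \<longlongrightarrow> (\<Sum>k\<le>degree p. coeff p k * 0)) at_top"
    by (intro tendsto_intros tendsto_power_div_exp_0)
  moreover have "(\<lambda>s. \<Sum>k\<le>degree p. coeff p k * (s ^ k / exp s)) = (\<lambda>s. poly p s * exp (- s))"
    by (simp add: poly_altdef sum_distrib_right exp_minus divide_inverse mult.assoc)
  ultimately show ?thesis by simp
qed

text \<open>
  For \<open>s = 1/t\<close> one has \<open>ds/dt = - s\<^sup>2\<close>, hence \<open>(p(s) e\<^sup>-\<^sup>s)' = s\<^sup>2 (p(s) - p'(s)) e\<^sup>-\<^sup>s\<close>. At \<open>t = 0\<close> the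
  difference quotient from the right is \<open>s p(s) e\<^sup>-\<^sup>s\<close> with \<open>s \<rightarrow> \<infinity>\<close>.
\<close>

lemma flat_exp_has_derivative:
  "(flat_exp p has_real_derivative flat_exp ([:0, 0, 1:] * (p - pderiv p)) t) (at t)"
proof -
  consider "t < 0" | "t > 0" | "t = 0" by linarith
  then show ?thesis
  proof cases
    case 1
    have "(flat_exp p has_real_derivative 0) (at t)"
      by (rule has_field_derivative_transform_within_open[of "\<lambda>_. 0" _ _ "{..<0}"])
        (use 1 in \<open>auto simp: flat_exp_def\<close>)
    then show ?thesis using 1 by (simp add: flat_exp_def)
  next
    case 2
    have "((\<lambda>t. poly p (inverse t) * exp (- inverse t)) has_real_derivative
        flat_exp ([:0, 0, 1:] * (p - pderiv p)) t) (at t)"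
      using 2 unfolding flat_exp_def
      by (auto intro!: derivative_eq_intros DERIV_chain2[OF poly_DERIV]
        simp: algebra_simps power2_eq_square)
    then show ?thesis
      by (rule has_field_derivative_transform_within_open[of _ _ _ "{0<..}"])
        (use 2 in \<open>auto simp: flat_exp_def\<close>)
  next
    case 3
    have "((\<lambda>h. flat_exp p h / h) \<longlongrightarrow> 0) (at_left 0)"
      by (rule tendsto_eventually) (auto simp: eventually_at_filter flat_exp_def)
    moreover have "((\<lambda>h. flat_exp p h / h) \<longlongrightarrow> 0) (at_right 0)"
    proof -
      have "((\<lambda>s. poly (pCons 0 p) s * exp (- s)) \<longlongrightarrow> 0) at_top"
        by (rule poly_times_exp_minus_tendsto_0)
      moreover have "\<forall>\<^sub>F s in at_top. poly (pCons 0 p) s * exp (- s) = flat_exp p (inverse s) / inverse s"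
        using eventually_gt_at_top[of 0] by eventually_elim (simp add: flat_exp_def field_simps)
      ultimately show ?thesis
        unfolding filterlim_at_right_to_top by (rule Lim_transform_eventually)
    qed
    ultimately have "((\<lambda>h. flat_exp p h / h) \<longlongrightarrow> 0) (at 0)"
      by (rule filterlim_split_at)
    then show ?thesis using 3 by (simp add: DERIV_def flat_exp_def)
  qed
qed

text \<open>
  Generating one algebra from polynomials and flat functions replaces a general theory of smooth
  functions: closure under partial derivatives follows by induction on the generation, and it
  yields the existence of all iterated partial derivatives at once.
\<close>

inductive_set smooth_alg :: "(real^'d::finite \<Rightarrow> real) set" where
  linear: "bounded_linear f \<Longrightarrow> f \<in> smooth_alg"
| const: "(\<lambda>x. c) \<in> smooth_alg"
| add: "f \<in> smooth_alg \<Longrightarrow> g \<in> smooth_alg \<Longrightarrow> (\<lambda>x. f x + g x) \<in> smooth_alg"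
| mult: "f \<in> smooth_alg \<Longrightarrow> g \<in> smooth_alg \<Longrightarrow> (\<lambda>x. f x * g x) \<in> smooth_alg"
| flat: "f \<in> smooth_alg \<Longrightarrow> (\<lambda>x. flat_exp p (f x)) \<in> smooth_alg"

lemma polynomial_in_smooth_alg: "real_polynomial_function f \<Longrightarrow> f \<in> smooth_alg"
  by (induction rule: real_polynomial_function.induct) (auto intro: smooth_alg.intros)

lemma smooth_alg_continuous: "f \<in> smooth_alg \<Longrightarrow> continuous_on S f"
proof (induction rule: smooth_alg.induct)
  case (flat f p)
  have "continuous_on UNIV (flat_exp p)"
    by (rule DERIV_continuous_on) (rule has_field_derivative_at_within[OF flat_exp_has_derivative])
  then show ?case using flat.IH
    by (rule continuous_on_compose2) simp
qed (auto intro: continuous_intros linear_continuous_on)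

lemma smooth_alg_has_partial:
  assumes "f \<in> smooth_alg"
  shows "\<exists>g\<in>smooth_alg. \<forall>x. ((\<lambda>t. f (x + t *\<^sub>R axis i 1)) has_real_derivative g x) (at 0)"
  using assms
proof (induction rule: smooth_alg.induct)
  case (linear f)
  interpret bounded_linear f by fact
  have "((\<lambda>t. f (x + t *\<^sub>R axis i 1)) has_real_derivative f (axis i 1)) (at 0)" for x
    by (auto simp: add scaleR intro!: derivative_eq_intros)
  then show ?case
    by (intro bexI[of _ "\<lambda>x. f (axis i 1)"] allI smooth_alg.const)
next
  case (const c)
  show ?case by (rule bexI[of _ "\<lambda>x. 0"]) (auto intro: smooth_alg.const)
next
  case (add f g)
  then obtain f' g' where "f' \<in> smooth_alg" "g' \<in> smooth_alg"
    and "\<And>x. ((\<lambda>t. f (x + t *\<^sub>R axis i 1)) has_real_derivative f' x) (at 0)"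
    and "\<And>x. ((\<lambda>t. g (x + t *\<^sub>R axis i 1)) has_real_derivative g' x) (at 0)"
    by blast
  then show ?case
    by (intro bexI[of _ "\<lambda>x. f' x + g' x"]) (auto intro: smooth_alg.intros derivative_intros)
next
  case (mult f g)
  then obtain f' g' where "f' \<in> smooth_alg" "g' \<in> smooth_alg"
    and "\<And>x. ((\<lambda>t. f (x + t *\<^sub>R axis i 1)) has_real_derivative f' x) (at 0)"
    and "\<And>x. ((\<lambda>t. g (x + t *\<^sub>R axis i 1)) has_real_derivative g' x) (at 0)"
    by blast
  with mult.hyps show ?case
    by (intro bexI[of _ "\<lambda>x. f' x * g x + f x * g' x"])
      (auto intro!: smooth_alg.add smooth_alg.mult derivative_eq_intros)
next
  case (flat f p)
  then obtain f' where "f' \<in> smooth_alg"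
    and f': "\<And>x. ((\<lambda>t. f (x + t *\<^sub>R axis i 1)) has_real_derivative f' x) (at 0)"
    by blast
  moreover have "((\<lambda>t. flat_exp p (f (x + t *\<^sub>R axis i 1))) has_real_derivative
      flat_exp ([:0, 0, 1:] * (p - pderiv p)) (f x) * f' x) (at 0)" for x
    using DERIV_chain2[of "flat_exp p" _ "\<lambda>t. f (x + t *\<^sub>R axis i 1)", OF _ f'[of x]]
      flat_exp_has_derivative[of p "f x"] by simp
  ultimately show ?case using flat.hyps
    by (intro bexI[of _ "\<lambda>x. flat_exp ([:0, 0, 1:] * (p - pderiv p)) (f x) * f' x"])
      (auto intro!: smooth_alg.mult smooth_alg.flat)
qed

lemma partialI:
  "(\<And>x. ((\<lambda>t. f (x + t *\<^sub>R axis i 1)) has_real_derivative g x) (at 0)) \<Longrightarrow> partial i f = g"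
  unfolding partial_def by (auto intro: DERIV_imp_deriv)

lemma
  assumes "f \<in> smooth_alg"
  shows partial_in_smooth_alg: "partial i f \<in> smooth_alg"
    and smooth_alg_partial:
      "((\<lambda>t. f (x + t *\<^sub>R axis i 1)) has_real_derivative partial i f x) (at 0)"
  using smooth_alg_has_partial[OF assms, of i] partialI by blast+

lemma foldr_partial_in_smooth_alg: "f \<in> smooth_alg \<Longrightarrow> foldr partial is f \<in> smooth_alg"
  by (induction "is") (auto intro: partial_in_smooth_alg)

lemma smooth_alg_smooth_on: "f \<in> smooth_alg \<Longrightarrow> smooth_on U f"
  unfolding smooth_on_def real_differentiable_def
  using smooth_alg_continuous smooth_alg_partial foldr_partial_in_smooth_alg by blast

lemma smooth_alg_sum:
  "finite I \<Longrightarrow> (\<And>k. k \<in> I \<Longrightarrow> f k \<in> smooth_alg) \<Longrightarrow> (\<lambda>x. \<Sum>k\<in>I. f k x) \<in> smooth_alg"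
  by (induction rule: finite_induct) (auto intro: smooth_alg.intros)

lemma smooth_alg_power: "f \<in> smooth_alg \<Longrightarrow> (\<lambda>x. f x ^ n) \<in> smooth_alg"
  by (induction n) (auto intro: smooth_alg.intros)

lemma smooth_alg_diff:
  assumes "f \<in> smooth_alg" "g \<in> smooth_alg"
  shows "(\<lambda>x. f x - g x) \<in> smooth_alg"
  using smooth_alg.add[OF assms(1) smooth_alg.mult[OF smooth_alg.const[of "-1"] assms(2)]] by simp

lemma partial_add:
  assumes "f \<in> smooth_alg" "g \<in> smooth_alg"
  shows "partial i (\<lambda>x. f x + g x) = (\<lambda>x. partial i f x + partial i g x)"
  by (rule partialI) (intro derivative_intros smooth_alg_partial assms)

lemma partial_mult:
  assumes "f \<in> smooth_alg" "g \<in> smooth_alg"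
  shows "partial i (\<lambda>x. f x * g x) = (\<lambda>x. partial i f x * g x + f x * partial i g x)"
  by (rule partialI) (auto intro!: derivative_eq_intros smooth_alg_partial assms)

lemma partial_const: "partial i (\<lambda>x. c) = (\<lambda>x. 0)"
  by (rule partialI) simp

lemma foldr_partial_add:
  assumes "f \<in> smooth_alg" "g \<in> smooth_alg"
  shows "foldr partial is (\<lambda>x. f x + g x) = (\<lambda>x. foldr partial is f x + foldr partial is g x)"
  by (induction "is") (simp_all add: partial_add foldr_partial_in_smooth_alg assms)

section \<open>Order of vanishing\<close>

text \<open>
  Vanishing of all iterated partial derivatives with fewer than \<open>n\<close> steps, in any order of the
  coordinates. The recursion differentiates innermost first, which suits the product rule.
\<close>

fun vanishes_to_order :: "nat \<Rightarrow> real^'d \<Rightarrow> (real^'d::finite \<Rightarrow> real) \<Rightarrow> bool" where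
  "vanishes_to_order 0 z f \<longleftrightarrow> True"
| "vanishes_to_order (Suc n) z f \<longleftrightarrow> f z = 0 \<and> (\<forall>i. vanishes_to_order n z (partial i f))"

lemma vanishes_to_order_SucD: "vanishes_to_order (Suc n) z f \<Longrightarrow> vanishes_to_order n z f"
  by (induction n arbitrary: f) auto

lemma vanishes_to_order_zero: "vanishes_to_order n z (\<lambda>x. 0)"
  by (induction n) (auto simp: partial_const)

lemma vanishes_to_order_add:
  "\<lbrakk>f \<in> smooth_alg; g \<in> smooth_alg; vanishes_to_order n z f; vanishes_to_order n z g\<rbrakk>
    \<Longrightarrow> vanishes_to_order n z (\<lambda>x. f x + g x)"
  by (induction n arbitrary: f g) (auto simp: partial_add partial_in_smooth_alg)

lemma vanishes_to_order_sum:
  assumes "finite I" "\<And>k. k \<in> I \<Longrightarrow> f k \<in> smooth_alg \<and> vanishes_to_order n z (f k)"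
  shows "vanishes_to_order n z (\<lambda>x. \<Sum>k\<in>I. f k x)"
  using assms
  by (induction rule: finite_induct)
    (auto intro!: vanishes_to_order_add smooth_alg_sum simp: vanishes_to_order_zero)

text \<open>Functions vanishing to order \<open>n\<close> form an ideal.\<close>

lemma vanishes_to_order_mult:
  "\<lbrakk>f \<in> smooth_alg; g \<in> smooth_alg; vanishes_to_order n z f\<rbrakk>
    \<Longrightarrow> vanishes_to_order n z (\<lambda>x. f x * g x)"
proof (induction n arbitrary: f g)
  case (Suc n)
  have "vanishes_to_order n z (\<lambda>x. partial i f x * g x + f x * partial i g x)" for i
    using Suc by (intro vanishes_to_order_add Suc.IH)
      (auto intro: smooth_alg.mult partial_in_smooth_alg vanishes_to_order_SucD)
  with Suc.prems show ?case by (simp add: partial_mult)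
qed simp

text \<open>
  In the product rule for \<open>f g\<close>, the term with the derivative of \<open>f\<close> has lost one order but
  regains it from \<open>g\<close> by induction, and the other term still contains \<open>f\<close>.
\<close>

lemma vanishes_to_order_mult_Suc:
  "\<lbrakk>f \<in> smooth_alg; g \<in> smooth_alg; vanishes_to_order n z f; g z = 0\<rbrakk>
    \<Longrightarrow> vanishes_to_order (Suc n) z (\<lambda>x. f x * g x)"
proof (induction n arbitrary: f)
  case (Suc n)
  have "vanishes_to_order (Suc n) z (\<lambda>x. partial i f x * g x + f x * partial i g x)" for i
  proof (rule vanishes_to_order_add)
    show "vanishes_to_order (Suc n) z (\<lambda>x. partial i f x * g x)"
      using Suc.prems by (intro Suc.IH) (auto intro: partial_in_smooth_alg)
    show "vanishes_to_order (Suc n) z (\<lambda>x. f x * partial i g x)"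
      by (rule vanishes_to_order_mult) (use Suc.prems in \<open>auto intro: partial_in_smooth_alg\<close>)
  qed (use Suc.prems in \<open>auto intro: smooth_alg.mult partial_in_smooth_alg\<close>)
  then have "\<forall>i. vanishes_to_order (Suc n) z (partial i (\<lambda>x. f x * g x))"
    using Suc.prems by (simp only: partial_mult) blast
  with Suc.prems show ?case by (subst vanishes_to_order.simps) simp
qed simp

lemma vanishes_to_order_power:
  "f \<in> smooth_alg \<Longrightarrow> f z = 0 \<Longrightarrow> vanishes_to_order n z (\<lambda>x. f x ^ n)"
proof (induction n)
  case (Suc n)
  then show ?case
    using vanishes_to_order_mult_Suc[of "\<lambda>x. f x ^ n" f n z]
    by (simp only: power_Suc2 smooth_alg_power)
qed simp

lemma foldr_partial_vanishes:
  "vanishes_to_order n z f \<Longrightarrow> length is < n \<Longrightarrow> foldr partial is f z = 0"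
proof (induction "is" arbitrary: f n rule: rev_induct)
  case Nil
  then show ?case by (cases n) auto
next
  case (snoc i "is")
  then obtain m where "n = Suc m" by (cases n) auto
  with snoc show ?case by auto
qed

lemma multi_deriv_foldr:
  "multi_deriv \<alpha> = foldr partial (concat (map (\<lambda>i. replicate (\<alpha> i) i) (sorted_list_of_set UNIV)))"
proof -
  have r: "foldr partial (replicate n i) = partial i ^^ n" for n and i :: 'a
    by (induction n) auto
  have "foldr (\<lambda>i. partial i ^^ \<alpha> i) xs = foldr partial (concat (map (\<lambda>i. replicate (\<alpha> i) i) xs))"
    for xs :: "'a list"
    by (induction xs) (simp_all add: r)
  then show ?thesis unfolding multi_deriv_def .
qed

lemma multi_deriv_add_vanishing:
  assumes "f \<in> smooth_alg" "g \<in> smooth_alg" "vanishes_to_order n z g" "(\<Sum>i\<in>UNIV. \<alpha> i) < n"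
  shows "multi_deriv \<alpha> (\<lambda>x. f x + g x) z = multi_deriv \<alpha> f z"
proof -
  have "length (concat (map (\<lambda>i. replicate (\<alpha> i) i) (sorted_list_of_set UNIV))) = (\<Sum>i\<in>UNIV. \<alpha> i)"
    by (simp add: length_concat comp_def sum_list_distinct_conv_sum_set)
  then show ?thesis
    using foldr_partial_vanishes[OF assms(3)] assms(4)
    by (simp add: multi_deriv_foldr foldr_partial_add[OF assms(1,2)])
qed

section \<open>Interpolation of jets\<close>

definition taylor_monomial :: "real^'d \<Rightarrow> ('d \<Rightarrow> nat) \<Rightarrow> real^'d::finite \<Rightarrow> real" where
  "taylor_monomial z k = (\<lambda>x. \<Prod>j\<in>UNIV. (x $ j - z $ j) ^ k j / fact (k j))"

lemma taylor_monomial_polynomial: "real_polynomial_function (taylor_monomial z k)"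
  unfolding taylor_monomial_def divide_inverse
  by (intro real_polynomial_function_prod real_polynomial_function.intros(2,4)
      real_polynomial_function_power real_polynomial_function_diff
      real_polynomial_function.intros(1) bounded_linear_vec_nth) auto

lemma partial_taylor_monomial:
  "partial i (taylor_monomial z k) =
    (if k i = 0 then (\<lambda>x. 0) else taylor_monomial z (k(i := k i - 1)))"
proof (rule partialI)
  fix x
  define P where "P = (\<Prod>j\<in>UNIV - {i}. (x $ j - z $ j) ^ k j / fact (k j))"
  have split: "taylor_monomial z l (x + t *\<^sub>R axis i 1)
      = (x $ i + t - z $ i) ^ l i / fact (l i) * P"
    if "\<And>j. j \<noteq> i \<Longrightarrow> l j = k j" for l t
    unfolding taylor_monomial_def P_def
    by (subst prod.remove[of _ i]) (auto simp: axis_def that intro!: prod.cong)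
  have D: "(if k i = 0 then (\<lambda>x. 0) else taylor_monomial z (k(i := k i - 1))) x =
      (if k i = 0 then 0 else (x $ i - z $ i) ^ (k i - 1) / fact (k i - 1) * P)"
    using split[of "k(i := k i - 1)" 0] by simp
  have "((\<lambda>t. (x $ i + t - z $ i) ^ k i / fact (k i) * P) has_real_derivative
      (if k i = 0 then 0 else (x $ i - z $ i) ^ (k i - 1) / fact (k i - 1) * P)) (at 0)"
  proof (cases "k i")
    case (Suc n)
    have "((\<lambda>t. x $ i + t - z $ i) has_real_derivative 1) (at 0)"
      by (auto intro!: derivative_eq_intros)
    from DERIV_cdivide[OF DERIV_power_Suc[OF this, of n], of "fact (Suc n)"]
    have "((\<lambda>t. (x $ i + t - z $ i) ^ Suc n / fact (Suc n)) has_real_derivative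
        real (Suc n) * (x $ i - z $ i) ^ n / fact (Suc n)) (at 0)"
      by simp
    also have "real (Suc n) * (x $ i - z $ i) ^ n / fact (Suc n) = (x $ i - z $ i) ^ n / fact n"
      by (simp only: fact_Suc of_nat_mult mult_divide_mult_cancel_left of_nat_neq_0 if_False)
        simp
    finally show ?thesis
      using DERIV_cmult_right[of _ _ 0 UNIV P] by (simp only: Suc nat.distinct if_False diff_Suc_1)
  qed simp
  then show "((\<lambda>t. taylor_monomial z k (x + t *\<^sub>R axis i 1)) has_real_derivative
      (if k i = 0 then (\<lambda>x. 0) else taylor_monomial z (k(i := k i - 1))) x) (at 0)"
    unfolding D split[of k, OF refl] .
qed

lemma partial_funpow_zero: "(partial i ^^ n) (\<lambda>x. 0) = (\<lambda>x. 0)"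
  by (induction n) (auto simp: partial_const)

lemma partial_funpow_taylor_monomial:
  "(partial i ^^ n) (taylor_monomial z k) =
    (if n \<le> k i then taylor_monomial z (k(i := k i - n)) else (\<lambda>x. 0))"
proof (induction n)
  case (Suc n)
  then show ?case by (auto simp: partial_taylor_monomial partial_const fun_upd_def[symmetric])
qed simp

lemma multi_deriv_taylor_monomial:
  "multi_deriv \<alpha> (taylor_monomial z k) z = (if \<alpha> = k then 1 else 0)"
proof -
  have *: "foldr (\<lambda>i. partial i ^^ \<alpha> i) xs (taylor_monomial z k) =
      (if \<forall>i\<in>set xs. \<alpha> i \<le> k i
       then taylor_monomial z (\<lambda>i. if i \<in> set xs then k i - \<alpha> i else k i) else (\<lambda>x. 0))"
    if "distinct xs" for xs
    using that
  proof (induction xs)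
    case (Cons j xs)
    have "(\<lambda>i. if i \<in> set xs then k i - \<alpha> i else k i)(j := k j - \<alpha> j)
        = (\<lambda>i. if i \<in> set (j # xs) then k i - \<alpha> i else k i)"
      by auto
    with Cons show ?case
      by (simp add: partial_funpow_taylor_monomial partial_funpow_zero)
  qed simp
  have at_centre: "taylor_monomial z l z = (if \<forall>i. l i = 0 then 1 else 0)" for l
    by (auto simp: taylor_monomial_def)
  have "multi_deriv \<alpha> (taylor_monomial z k) z =
      (if \<forall>i. \<alpha> i \<le> k i then taylor_monomial z (\<lambda>i. k i - \<alpha> i) z else 0)"
    unfolding multi_deriv_def by (simp add: *)
  also have "\<dots> = (if \<alpha> = k then 1 else 0)"
    by (auto simp: at_centre fun_eq_iff intro: le_antisym)
  finally show ?thesis .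
qed

text \<open>
  The factor of the monomial is \<open>1\<close> to order \<open>n\<close> at \<open>x\<close> and \<open>0\<close> to order \<open>n\<close> at the other points
  of \<open>F\<close>, provided that \<open>g x\<close> is \<open>1\<close> at \<open>x\<close> and \<open>0\<close> at the other points. It is zero
  wherever \<open>g x\<close> is, so that bounds on the support carry over.
\<close>

definition jet_interpolant ::
  "nat \<Rightarrow> (real^'d) set \<Rightarrow> (real^'d \<Rightarrow> real^'d \<Rightarrow> real) \<Rightarrow> (real^'d \<Rightarrow> 'd \<Rightarrow> nat) \<Rightarrow> real^'d::finite \<Rightarrow> real"
  where "jet_interpolant n F g a =
    (\<lambda>y. \<Sum>x\<in>F. (1 - (1 - g x y ^ n) ^ n) * taylor_monomial x (a x) y)"

lemma jet_interpolant_in_smooth_alg: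
  assumes "finite F" "\<And>x. x \<in> F \<Longrightarrow> g x \<in> smooth_alg"
  shows "jet_interpolant n F g a \<in> smooth_alg"
  unfolding jet_interpolant_def
  by (intro smooth_alg_sum smooth_alg.mult smooth_alg_diff smooth_alg_power smooth_alg.const assms
      polynomial_in_smooth_alg[OF taylor_monomial_polynomial])

text \<open>
  Up to a function \<open>h\<close> in the ideal of functions vanishing to order \<open>n\<close> at \<open>z\<close>, the interpolant is
  the monomial centred at \<open>z\<close>, whose derivatives at \<open>z\<close> are known.
\<close>

lemma multi_deriv_jet_interpolant:
  fixes F :: "(real^'d::{finite,linorder}) set"
  assumes F: "finite F" "z \<in> F"
    and g: "\<And>x. x \<in> F \<Longrightarrow> g x \<in> smooth_alg"
    and delta: "\<And>x y. x \<in> F \<Longrightarrow> y \<in> F \<Longrightarrow> g x y = (if x = y then 1 else 0)"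
    and \<alpha>: "(\<Sum>i\<in>UNIV. \<alpha> i) < n"
  shows "multi_deriv \<alpha> (jet_interpolant n F g a) z = (if \<alpha> = a z then 1 else 0)"
proof -
  define m where "m x = taylor_monomial x (a x)" for x
  have m: "m x \<in> smooth_alg" for x
    unfolding m_def by (rule polynomial_in_smooth_alg[OF taylor_monomial_polynomial])
  define q where "q x = (\<lambda>y. 1 - g x y ^ n)" for x
  have q: "q x \<in> smooth_alg" if "x \<in> F" for x
    unfolding q_def by (intro smooth_alg_diff smooth_alg_power smooth_alg.const g that)
  have \<chi>: "(\<lambda>y. 1 - q x y ^ n) \<in> smooth_alg" if "x \<in> F" for x
    by (intro smooth_alg_diff smooth_alg_power smooth_alg.const q that)
  define h where "h = (\<lambda>y. q z y ^ n * - m z y + (\<Sum>x\<in>F - {z}. (1 - q x y ^ n) * m x y))"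
  have mz: "(\<lambda>y. - m z y) \<in> smooth_alg"
    using smooth_alg_diff[OF smooth_alg.const[of 0] m[of z]] by simp
  have h1: "(\<lambda>y. q z y ^ n * - m z y) \<in> smooth_alg"
    by (intro smooth_alg.mult smooth_alg_power mz q F)
  have h2: "(\<lambda>y. \<Sum>x\<in>F - {z}. (1 - q x y ^ n) * m x y) \<in> smooth_alg"
    using F by (intro smooth_alg_sum smooth_alg.mult m \<chi>) auto
  have "h \<in> smooth_alg" unfolding h_def by (intro smooth_alg.add h1 h2)
  moreover have "vanishes_to_order n z h"
    unfolding h_def
  proof (intro vanishes_to_order_add h1 h2 vanishes_to_order_sum)
    show "vanishes_to_order n z (\<lambda>y. q z y ^ n * - m z y)"
      by (intro vanishes_to_order_mult vanishes_to_order_power smooth_alg_power mz q F)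
        (simp add: q_def delta F)
    fix x assume x: "x \<in> F - {z}"
    \<comment> \<open>As \<open>1 - q x = (g x)\<^sup>n\<close>, the geometric sum shows that \<open>(g x)\<^sup>n\<close> divides \<open>1 - (q x)\<^sup>n\<close>.\<close>
    have "1 - q x y ^ n = g x y ^ n * (\<Sum>i<n. q x y ^ i)" for y
      using one_diff_power_eq[of "q x y" n] by (simp add: q_def)
    moreover have "vanishes_to_order n z (\<lambda>y. g x y ^ n * ((\<Sum>i<n. q x y ^ i) * m x y))"
    proof (intro vanishes_to_order_mult vanishes_to_order_power smooth_alg.mult smooth_alg_sum
        smooth_alg_power m)
    qed (use x F in \<open>auto simp: delta intro: g q\<close>)
    ultimately have "vanishes_to_order n z (\<lambda>y. (1 - q x y ^ n) * m x y)"
      by (simp add: mult.assoc)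
    moreover have "(\<lambda>y. (1 - q x y ^ n) * m x y) \<in> smooth_alg"
      using x by (intro smooth_alg.mult \<chi> m) simp
    ultimately show "(\<lambda>y. (1 - q x y ^ n) * m x y) \<in> smooth_alg \<and>
        vanishes_to_order n z (\<lambda>y. (1 - q x y ^ n) * m x y)"
      by blast
  qed (use F in auto)
  moreover have "jet_interpolant n F g a = (\<lambda>y. m z y + h y)"
    unfolding jet_interpolant_def h_def m_def q_def
    by (subst sum.remove[OF F]) (simp add: algebra_simps)
  ultimately show ?thesis
    using multi_deriv_add_vanishing[OF m[of z] _ _ \<alpha>, of h z]
    by (simp add: m_def multi_deriv_taylor_monomial)
qed

lemma lagrange_polynomials:
  fixes F :: "(real^'d::finite) set"
  assumes "finite F"
  obtains g where "\<And>x. real_polynomial_function (g x)"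
    and "\<And>x y. x \<in> F \<Longrightarrow> y \<in> F \<Longrightarrow> g x y = (if x = y then 1 else 0)"
proof
  \<comment> \<open>Squared distances are polynomials that vanish at exactly one point.\<close>
  define g where "g x y = (\<Prod>z\<in>F - {x}. ((y - z) \<bullet> (y - z)) / ((x - z) \<bullet> (x - z)))" for x y
  show "real_polynomial_function (g x)" for x
  proof -
    have "real_polynomial_function (\<lambda>y. (y - z) \<bullet> (y - z))" for z :: "real^'d"
      unfolding inner_vec_def inner_real_def vector_minus_component
      by (intro real_polynomial_function_sum real_polynomial_function.intros(2,4)
        real_polynomial_function_diff real_polynomial_function.intros(1) bounded_linear_vec_nth) auto
    then show ?thesis
      unfolding g_def[abs_def] divide_inverse
      by (intro real_polynomial_function_prod real_polynomial_function.intros(2,4)) (use assms in auto)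
  qed
  show "g x y = (if x = y then 1 else 0)" if "x \<in> F" "y \<in> F" for x y
  proof (cases "x = y")
    case True
    then show ?thesis by (auto simp: g_def intro!: prod.neutral split: if_splits)
  next
    case False
    then show ?thesis using that assms by (auto simp: g_def intro!: prod_zero bexI[of _ y])
  qed
qed

lemma bump_functions:
  fixes F :: "(real^'d::finite) set"
  assumes "finite F" "open U" "F \<subseteq> U"
  obtains g K where "\<And>x. g x \<in> smooth_alg"
    and "\<And>x y. x \<in> F \<Longrightarrow> y \<in> F \<Longrightarrow> g x y = (if x = y then 1 else 0)"
    and "compact K" "K \<subseteq> U" "\<And>x y. x \<in> F \<Longrightarrow> g x y \<noteq> 0 \<Longrightarrow> y \<in> K"
proof -
  have "\<exists>\<rho>>0. cball x \<rho> \<subseteq> U - (F - {x})" if "x \<in> F" for x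
    using assms that by (intro open_contains_cball[THEN iffD1, rule_format])
      (auto intro!: open_Diff finite_imp_closed)
  then obtain \<rho> where \<rho>: "\<And>x. x \<in> F \<Longrightarrow> \<rho> x > 0 \<and> cball x (\<rho> x) \<subseteq> U - (F - {x})"
    by metis
  \<comment> \<open>Positive exactly inside the ball of radius \<open>\<rho> x\<close> about \<open>x\<close>, and normalised at the centre.\<close>
  define g where "g x y = flat_exp 1 ((\<rho> x)\<^sup>2 - (y - x) \<bullet> (y - x)) * inverse (flat_exp 1 ((\<rho> x)\<^sup>2))" for x y
  have supp: "y \<in> cball x (\<rho> x)" if "x \<in> F" "g x y \<noteq> 0" for x y
  proof -
    have "(y - x) \<bullet> (y - x) < (\<rho> x)\<^sup>2"
      using that(2) by (auto simp: g_def flat_exp_def split: if_splits)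
    then have "norm (y - x) < \<rho> x"
      using \<rho>[OF that(1)] by (simp add: power2_norm_eq_inner[symmetric] power_less_imp_less_base)
    then show ?thesis by (simp add: dist_norm norm_minus_commute)
  qed
  show thesis
  proof (rule that[of g "\<Union>x\<in>F. cball x (\<rho> x)"])
    fix x
    have "real_polynomial_function (\<lambda>y. (\<rho> x)\<^sup>2 - (y - x) \<bullet> (y - x))"
      unfolding inner_vec_def inner_real_def vector_minus_component
      by (intro real_polynomial_function_sum real_polynomial_function.intros(2,4)
        real_polynomial_function_diff real_polynomial_function.intros(1) bounded_linear_vec_nth) auto
    then show "g x \<in> smooth_alg"
      unfolding g_def[abs_def]
      by (intro smooth_alg.mult smooth_alg.flat smooth_alg.const polynomial_in_smooth_alg)
  next
    fix x y assume xy: "x \<in> F" "y \<in> F"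
    show "g x y = (if x = y then 1 else 0)"
    proof (cases "x = y")
      case True
      then show ?thesis using \<rho>[OF xy(1)] by (simp add: g_def flat_exp_def)
    next
      case False
      with \<rho>[OF xy(1)] xy have "y \<notin> cball x (\<rho> x)" by blast
      with supp[OF xy(1), of y] False show ?thesis by (cases "g x y = 0") simp_all
    qed
  next
    show "compact (\<Union>x\<in>F. cball x (\<rho> x))" using assms by (intro compact_UN) auto
    show "(\<Union>x\<in>F. cball x (\<rho> x)) \<subseteq> U" using \<rho> by blast
    show "y \<in> (\<Union>x\<in>F. cball x (\<rho> x))" if "x \<in> F" "g x y \<noteq> 0" for x y
      using supp that by blast
  qed
qed

section \<open>Detecting linear dependence of operators\<close>

text \<open>
  Induction on \<open>r\<close>. Points that detect all relations among the first \<open>r\<close> operators leave at most a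
  line of coefficient vectors \<open>c\<close> for \<open>r + 1\<close> operators, because two of them can be combined to
  cancel the last entry. If a line remains, one more pair \<open>(y, \<alpha>)\<close> with \<open>\<Sum> c\<^sub>i p\<^sub>i\<^sub>,\<^sub>\<alpha>(y) \<noteq> 0\<close>
  eliminates it; such \<open>y\<close> fill a nonempty open set, which is infinite, so a new one can be chosen.
\<close>

lemma separating_points:
  fixes U :: "(real^'d::finite) set" and L :: "nat \<Rightarrow> 'd diff_op"
  assumes "open U" and cont: "\<And>i \<alpha>. i \<in> {1..r} \<Longrightarrow> continuous_on U (L i \<alpha>)"
    and "\<not> lin_dep_ops U r L"
  shows "\<exists>F a. finite F \<and> F \<subseteq> U \<and>
    (\<forall>c. (\<forall>x\<in>F. (\<Sum>i=1..r. c i * L i (a x) x) = 0) \<longrightarrow> (\<forall>i\<in>{1..r}. c i = 0))"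
  using cont assms(3)
proof (induction r)
  case 0
  then show ?case by (intro exI[of _ "{}"]) auto
next
  case (Suc r)
  have "\<not> lin_dep_ops U r L"
  proof
    assume "lin_dep_ops U r L"
    then obtain c i where "i \<in> {1..r}" "c i \<noteq> 0"
      and "\<And>\<alpha> x. x \<in> U \<Longrightarrow> (\<Sum>i=1..r. c i * L i \<alpha> x) = 0"
      unfolding lin_dep_ops_def by blast
    then have "lin_dep_ops U (Suc r) L"
      unfolding lin_dep_ops_def
      by (intro exI[of _ "c(Suc r := 0)"]) (auto intro!: bexI[of _ i] sum.neutral)
    with Suc.prems show False by simp
  qed
  moreover have "continuous_on U (L i \<alpha>)" if "i \<in> {1..r}" for i \<alpha>
    using that Suc.prems(1) by simp
  ultimately obtain F a where F: "finite F" "F \<subseteq> U"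
    and sep: "\<And>c. \<forall>x\<in>F. (\<Sum>i=1..r. c i * L i (a x) x) = 0 \<Longrightarrow> \<forall>i\<in>{1..r}. c i = 0"
    using Suc.IH by blast
  show ?case
  proof (cases "\<forall>c. (\<forall>x\<in>F. (\<Sum>i=1..Suc r. c i * L i (a x) x) = 0) \<longrightarrow> (\<forall>i\<in>{1..Suc r}. c i = 0)")
    case True
    with F show ?thesis by blast
  next
    case False
    then obtain c where c: "\<And>x. x \<in> F \<Longrightarrow> (\<Sum>i=1..Suc r. c i * L i (a x) x) = 0"
      and nz: "\<exists>i\<in>{1..Suc r}. c i \<noteq> 0" by blast
    have last: "c (Suc r) \<noteq> 0"
    proof
      assume "c (Suc r) = 0"
      with c sep[of c] nz show False by (auto simp: le_Suc_eq)
    qed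
    obtain \<alpha> x where x: "x \<in> U" "(\<Sum>i=1..Suc r. c i * L i \<alpha> x) \<noteq> 0"
      using Suc.prems(2) nz unfolding lin_dep_ops_def by blast
    define W where "W = U \<inter> (\<lambda>x. \<Sum>i=1..Suc r. c i * L i \<alpha> x) -` (- {0})"
    have "open W" unfolding W_def
      by (rule continuous_open_preimage)
        (auto intro!: continuous_intros Suc.prems(1) assms(1) simp del: sum.cl_ivl_Suc)
    moreover have "x \<in> W" using x by (simp add: W_def)
    ultimately have "infinite W" using finite_imp_not_open by blast
    then obtain y where y: "y \<in> W" "y \<notin> F"
      using F(1) by (meson finite_subset subsetI)
    have "\<forall>i\<in>{1..Suc r}. d i = 0"
      if d: "\<forall>x\<in>insert y F. (\<Sum>i=1..Suc r. d i * L i ((a(y := \<alpha>)) x) x) = 0" for d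
    proof -
      define t where "t = d (Suc r) / c (Suc r)"
      have "(\<Sum>i=1..Suc r. (d i - t * c i) * L i (a x) x) = 0" if "x \<in> F" for x
      proof -
        have "(\<Sum>i=1..Suc r. (d i - t * c i) * L i (a x) x) =
          (\<Sum>i=1..Suc r. d i * L i (a x) x) - t * (\<Sum>i=1..Suc r. c i * L i (a x) x)"
          by (simp only: sum_distrib_left sum_subtractf[symmetric])
            (auto simp: algebra_simps intro!: sum.cong)
        also have "(\<Sum>i=1..Suc r. d i * L i (a x) x) = 0"
          using d[rule_format, of x] that y(2) by (cases "x = y") (simp_all del: sum.cl_ivl_Suc)
        also have "0 - t * (\<Sum>i=1..Suc r. c i * L i (a x) x) = 0"
          using c[OF that] by (simp del: sum.cl_ivl_Suc)
        finally show ?thesis .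
      qed
      moreover have t: "d (Suc r) - t * c (Suc r) = 0" using last by (simp add: t_def)
      ultimately have "\<forall>i\<in>{1..r}. d i - t * c i = 0"
        by (intro sep) simp
      with t have proportional: "d i = t * c i" if "i \<in> {1..Suc r}" for i
        using that by (auto simp: le_Suc_eq)
      have "0 = (\<Sum>i=1..Suc r. d i * L i \<alpha> y)" using d by (simp del: sum.cl_ivl_Suc)
      also have "\<dots> = t * (\<Sum>i=1..Suc r. c i * L i \<alpha> y)"
        unfolding sum_distrib_left by (intro sum.cong) (simp_all add: proportional del: sum.cl_ivl_Suc)
      finally have "t = 0" using y(1) by (auto simp: W_def simp del: sum.cl_ivl_Suc)
      with proportional show ?thesis by simp
    qed
    then show ?thesis using F y
      by (intro exI[of _ "insert y F"] exI[of _ "a(y := \<alpha>)"]) (auto simp: W_def simp del: sum.cl_ivl_Suc)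
  qed
qed

lemma lin_dep_ops_imp_lin_dep_funs:
  assumes L: "\<And>i. i \<in> {1..r} \<Longrightarrow> linear_pdo U (L i)" and "lin_dep_ops U r L"
  shows "lin_dep_funs U r (\<lambda>i. apply_op U (L i) \<phi>)"
proof -
  from assms(2) obtain c where nz: "\<exists>i\<in>{1..r}. c i \<noteq> 0"
    and c: "\<And>\<alpha> x. x \<in> U \<Longrightarrow> (\<Sum>i=1..r. c i * L i \<alpha> x) = 0"
    unfolding lin_dep_ops_def by blast
  define A where "A = (\<Union>i\<in>{1..r}. {\<alpha>. \<exists>y\<in>U. L i \<alpha> y \<noteq> 0})"
  have A: "finite A" using L by (auto simp: A_def linear_pdo_def)
  have app: "apply_op U (L i) \<phi> x = (\<Sum>\<alpha>\<in>A. L i \<alpha> x * multi_deriv \<alpha> \<phi> x)"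
    if "i \<in> {1..r}" "x \<in> U" for i x
    unfolding apply_op_def by (rule sum.mono_neutral_left) (use A that in \<open>auto simp: A_def\<close>)
  have "(\<Sum>i=1..r. c i * apply_op U (L i) \<phi> x) = 0" if "x \<in> U" for x
  proof -
    have "(\<Sum>i=1..r. c i * apply_op U (L i) \<phi> x) =
        (\<Sum>i=1..r. \<Sum>\<alpha>\<in>A. c i * L i \<alpha> x * multi_deriv \<alpha> \<phi> x)"
      using that by (intro sum.cong) (simp_all add: app sum_distrib_left mult.assoc)
    also have "\<dots> = (\<Sum>\<alpha>\<in>A. (\<Sum>i=1..r. c i * L i \<alpha> x) * multi_deriv \<alpha> \<phi> x)"
      by (subst sum.swap) (simp add: sum_distrib_right)
    finally show ?thesis using c[OF that] by simp
  qed
  with nz show ?thesis unfolding lin_dep_funs_def by blast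
qed

lemma apply_op_at_monomial_jet:
  assumes "linear_pdo U L" "z \<in> U"
    and "\<And>\<alpha>. \<exists>y\<in>U. L \<alpha> y \<noteq> 0 \<Longrightarrow> multi_deriv \<alpha> \<phi> z = (if \<alpha> = \<beta> then 1 else 0)"
  shows "apply_op U L \<phi> z = L \<beta> z"
proof -
  have "apply_op U L \<phi> z = (\<Sum>\<alpha> | \<exists>y\<in>U. L \<alpha> y \<noteq> 0. if \<alpha> = \<beta> then L \<beta> z else 0)"
    unfolding apply_op_def by (rule sum.cong) (use assms(3) in auto)
  also have "\<dots> = L \<beta> z" using assms(1,2) by (auto simp: linear_pdo_def)
  finally show ?thesis .
qed

text \<open>
  The class \<open>\<Phi>\<close> of test functions matters only through its ability to realise a monomial jet at
  each point of a finite set; both parts of the theorem are instances.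
\<close>

lemma interpolation_imp_lin_dep_ops:
  fixes U :: "(real, 'd::{finite,linorder}) vec set" and L :: "nat \<Rightarrow> 'd diff_op"
  assumes "open U"
    and L: "\<And>i. i \<in> {1..r} \<Longrightarrow> linear_pdo U (L i)"
    and interp: "\<And>F a n. finite F \<Longrightarrow> F \<subseteq> U \<Longrightarrow> \<exists>\<phi>\<in>\<Phi>. \<forall>z\<in>F. \<forall>\<alpha>. (\<Sum>i\<in>UNIV. \<alpha> i) < n \<longrightarrow>
      multi_deriv \<alpha> \<phi> z = (if \<alpha> = a z then 1 else 0)"
    and dep: "\<forall>\<phi>\<in>\<Phi>. lin_dep_funs U r (\<lambda>i. apply_op U (L i) \<phi>)"
  shows "lin_dep_ops U r L"
proof (rule ccontr)
  assume "\<not> lin_dep_ops U r L"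
  moreover have "continuous_on U (L i \<alpha>)" if "i \<in> {1..r}" for i \<alpha>
    using L[OF that] by (simp add: linear_pdo_def)
  ultimately obtain F a where F: "finite F" "F \<subseteq> U"
    and sep: "\<And>c. \<forall>x\<in>F. (\<Sum>i=1..r. c i * L i (a x) x) = 0 \<Longrightarrow> \<forall>i\<in>{1..r}. c i = 0"
    using separating_points[OF assms(1), of r L] by blast
  define A where "A = (\<Union>i\<in>{1..r}. {\<alpha>. \<exists>y\<in>U. L i \<alpha> y \<noteq> 0})"
  have A: "finite A" using L by (auto simp: A_def linear_pdo_def)
  obtain n where n: "\<And>\<alpha>. \<alpha> \<in> A \<Longrightarrow> (\<Sum>i\<in>UNIV. \<alpha> i) < n"
    using finite_nat_set_iff_bounded[THEN iffD1, OF finite_imageI[OF A, of "\<lambda>\<alpha>. \<Sum>i\<in>UNIV. \<alpha> i"]]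
    by blast
  obtain \<phi> where "\<phi> \<in> \<Phi>" and \<phi>: "\<And>z \<alpha>. z \<in> F \<Longrightarrow> (\<Sum>i\<in>UNIV. \<alpha> i) < n \<Longrightarrow>
      multi_deriv \<alpha> \<phi> z = (if \<alpha> = a z then 1 else 0)"
    using interp[OF F, of n a] by blast
  have app: "apply_op U (L i) \<phi> z = L i (a z) z" if "i \<in> {1..r}" "z \<in> F" for i z
  proof (rule apply_op_at_monomial_jet)
    fix \<alpha> assume "\<exists>y\<in>U. L i \<alpha> y \<noteq> 0"
    with that have "\<alpha> \<in> A" by (auto simp: A_def)
    then show "multi_deriv \<alpha> \<phi> z = (if \<alpha> = a z then 1 else 0)" by (intro \<phi> n that)
  qed (use that L F in auto)
  obtain c where nz: "\<exists>i\<in>{1..r}. c i \<noteq> 0"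
    and c: "\<And>x. x \<in> U \<Longrightarrow> (\<Sum>i=1..r. c i * apply_op U (L i) \<phi> x) = 0"
    using dep \<open>\<phi> \<in> \<Phi>\<close> unfolding lin_dep_funs_def by blast
  have "(\<Sum>i=1..r. c i * L i (a x) x) = 0" if "x \<in> F" for x
    using c[of x] F that by (auto simp: app)
  with sep nz show False by blast
qed

section \<open>The two classes of test functions\<close>

lemma polynomial_jet_interpolation:
  fixes F :: "(real, 'd::{finite,linorder}) vec set"
  assumes "finite F"
  shows "\<exists>\<phi>\<in>{\<phi>. real_polynomial_function \<phi>}. \<forall>z\<in>F. \<forall>\<alpha>. (\<Sum>i\<in>UNIV. \<alpha> i) < n \<longrightarrow>
    multi_deriv \<alpha> \<phi> z = (if \<alpha> = a z then 1 else 0)"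
proof -
  obtain g :: "(real, 'd) vec \<Rightarrow> (real, 'd) vec \<Rightarrow> real"
    where g: "\<And>x. real_polynomial_function (g x)"
    "\<And>x y. x \<in> F \<Longrightarrow> y \<in> F \<Longrightarrow> g x y = (if x = y then 1 else 0)"
    using lagrange_polynomials[OF assms] by blast
  have "real_polynomial_function (jet_interpolant n F g a)"
    unfolding jet_interpolant_def
    by (intro real_polynomial_function_sum real_polynomial_function.intros(2,4)
        real_polynomial_function_power real_polynomial_function_diff taylor_monomial_polynomial
        g(1) assms)
  then show ?thesis
    using multi_deriv_jet_interpolant[OF assms _ polynomial_in_smooth_alg[OF g(1)] g(2)] by blast
qed

lemma Cinf_c_jet_interpolation:
  fixes F :: "(real, 'd::{finite,linorder}) vec set"
  assumes F: "finite F" "open U" "F \<subseteq> U"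
  shows "\<exists>\<phi>\<in>Cinf_c U. \<forall>z\<in>F. \<forall>\<alpha>. (\<Sum>i\<in>UNIV. \<alpha> i) < n \<longrightarrow>
    multi_deriv \<alpha> \<phi> z = (if \<alpha> = a z then 1 else 0)"
proof -
  obtain g :: "(real, 'd) vec \<Rightarrow> (real, 'd) vec \<Rightarrow> real" and K where g: "\<And>x. g x \<in> smooth_alg"
    "\<And>x y. x \<in> F \<Longrightarrow> y \<in> F \<Longrightarrow> g x y = (if x = y then 1 else 0)"
    and K: "compact K" "K \<subseteq> U" "\<And>x y. x \<in> F \<Longrightarrow> g x y \<noteq> 0 \<Longrightarrow> y \<in> K"
    using bump_functions[OF assms] by blast
  define \<phi> where "\<phi> = jet_interpolant n F g a"
  have "{x\<in>U. \<phi> x \<noteq> 0} \<subseteq> K"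
  proof clarify
    fix y assume "\<phi> y \<noteq> 0"
    then obtain x where "x \<in> F" "g x y \<noteq> 0"
      unfolding \<phi>_def jet_interpolant_def
      by (cases n) (force elim: sum.not_neutral_contains_not_neutral)+
    then show "y \<in> K" by (rule K(3))
  qed
  then have "closure {x\<in>U. \<phi> x \<noteq> 0} \<subseteq> K"
    using K(1) by (intro closure_minimal compact_imp_closed)
  then have "U \<inter> closure {x\<in>U. \<phi> x \<noteq> 0} = K \<inter> closure {x\<in>U. \<phi> x \<noteq> 0}"
    using K(2) by blast
  then have "compact (U \<inter> closure {x\<in>U. \<phi> x \<noteq> 0})"
    using K(1) by (simp add: compact_Int_closed)
  moreover have "smooth_on U \<phi>"
    unfolding \<phi>_def by (intro smooth_alg_smooth_on jet_interpolant_in_smooth_alg F g)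
  ultimately have "\<phi> \<in> Cinf_c U" by (simp add: Cinf_c_def)
  moreover have "multi_deriv \<alpha> \<phi> z = (if \<alpha> = a z then 1 else 0)"
    if "z \<in> F" "(\<Sum>i\<in>UNIV. \<alpha> i) < n" for z \<alpha>
    unfolding \<phi>_def by (rule multi_deriv_jet_interpolant) (use that F g in auto)
  ultimately show ?thesis by blast
qed

theorem theorem1:
  fixes U :: "(real, 'd::{finite,linorder}) vec set"
    and L :: "nat \<Rightarrow> 'd diff_op"
    and r :: nat
  assumes "open U"
    and "r \<ge> 1"
    and "\<And>i. i \<in> {1..r} \<Longrightarrow> linear_pdo U (L i)"
  shows "((\<forall>\<phi>\<in>Cinf_c U. lin_dep_funs U r (\<lambda>i. apply_op U (L i) \<phi>)) \<longleftrightarrow> lin_dep_ops U r L) \<and>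
         ((\<forall>\<phi>. real_polynomial_function \<phi> \<longrightarrow> lin_dep_funs U r (\<lambda>i. apply_op U (L i) \<phi>))
            \<longleftrightarrow> lin_dep_ops U r L)"
proof (intro conjI iffI ballI allI impI)
  assume "\<forall>\<phi>\<in>Cinf_c U. lin_dep_funs U r (\<lambda>i. apply_op U (L i) \<phi>)"
  then show "lin_dep_ops U r L"
    by (rule interpolation_imp_lin_dep_ops[rotated 3])
      (use assms Cinf_c_jet_interpolation in blast)+
next
  assume "\<forall>\<phi>. real_polynomial_function \<phi> \<longrightarrow> lin_dep_funs U r (\<lambda>i. apply_op U (L i) \<phi>)"
  then have "\<forall>\<phi>\<in>{\<phi>. real_polynomial_function \<phi>}. lin_dep_funs U r (\<lambda>i. apply_op U (L i) \<phi>)"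
    by simp
  then show "lin_dep_ops U r L"
    by (rule interpolation_imp_lin_dep_ops[rotated 3])
      (use assms polynomial_jet_interpolation in blast)+
qed (intro lin_dep_ops_imp_lin_dep_funs assms; assumption)+

end
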